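(* Let $n\ge 1$, let $K_n$ be the complete graph on $n$ vertices, and let $G$ be a simple connected graph. (1) If $A^{\operatorname{trs}}(G)$ and $A^{\operatorname{trs}}(K_n)$ have the same Smith normal form, then $G$ is isomorphic to $K_n$. (2) If $A^{\operatorname{trs}}_+(G)$ and $A^{\operatorname{trs}}_+(K_n)$ have the same Smith normal form, then $G$ is isomorphic to $K_n$. (That is, complete graphs are determined by the SNF of $A^{\operatorname{trs}}$, and complete graphs are determined by the SNF of $A^{\operatorname{trs}}_+$.)
   Context: For a connected graph $G$, $A(G)$ is the adjacency matrix and $\operatorname{trs}(G)$ is the diagonal matrix of transmissions $\operatorname{trs}(u)=\sum_{v\in V(G)}\operatorname{dist}(u,v)$, where $\operatorname{dist}(u,v)$ is the number of edges in a shortest path between $u$ and $v$. Define $A^{\operatorname{trs}}(G)=\operatorname{trs}(G)-A(G)$ and $A^{\operatorname{trs}}_+(G)=\operatorname{trs}(G)+A(G)$. The Smith normal form (SNF) of a square integer matrix $M$ of size $n$ is the unique diagonal matrix $\operatorname{diag}(f_1,\dots,f_r,0,\dots,0)=PMQ$ with $P,Q\in GL_n(\mathbb{Z})$, $f_i$ positive integers, $f_i\mid f_{i+1}$, $r$ the rank of $M$ (so matrices with equal SNF have the same size). *)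

theory Defs
  imports
    "Graph_Theory.Graph_Theory"
    "Jordan_Normal_Form.DL_Rank"
begin

text \<open>
  Graphs are those of \<^theory>\<open>Graph_Theory.Digraph\<close>: the locale \<^locale>\<open>graph\<close> describes finite
  simple graphs, an undirected edge being represented by a pair of opposite arcs. So the length of
  an arc path is the number of edges of the corresponding undirected path.
\<close>

definition graph_dist :: "('a, 'b) pre_digraph \<Rightarrow> 'a \<Rightarrow> 'a \<Rightarrow> nat" where
  "graph_dist G u v = (LEAST k. \<exists>p. pre_digraph.apath G u p v \<and> length p = k)"

definition transmission :: "('a, 'b) pre_digraph \<Rightarrow> 'a \<Rightarrow> nat" where
  "transmission G u = (\<Sum>v\<in>verts G. graph_dist G u v)"

text \<open>
  Matrices are indexed by natural numbers, hence the graph matrices take as additional argument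
  an enumeration \<open>vs\<close> of the vertices (a distinct list with \<open>set vs = verts G\<close>); row and column
  \<open>i\<close> belong to the vertex \<open>vs ! i\<close>.
\<close>

definition adjacency_matrix :: "('a, 'b) pre_digraph \<Rightarrow> 'a list \<Rightarrow> int mat" where
  "adjacency_matrix G vs = mat (length vs) (length vs)
     (\<lambda>(i, j). if (vs ! i, vs ! j) \<in> arcs_ends G then 1 else 0)"

definition trs_matrix :: "('a, 'b) pre_digraph \<Rightarrow> 'a list \<Rightarrow> int mat" where
  "trs_matrix G vs = mat_diag (length vs) (\<lambda>i. int (transmission G (vs ! i)))"

definition Atrs :: "('a, 'b) pre_digraph \<Rightarrow> 'a list \<Rightarrow> int mat" where
  "Atrs G vs = trs_matrix G vs - adjacency_matrix G vs"

definition Atrs_plus :: "('a, 'b) pre_digraph \<Rightarrow> 'a list \<Rightarrow> int mat" where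
  "Atrs_plus G vs = trs_matrix G vs + adjacency_matrix G vs"

text \<open>
  \<open>is_smith_normal_form M S\<close>: \<open>S\<close> is the Smith normal form of the square integer matrix \<open>M\<close>.
  Since \<open>P\<close> and \<open>Q\<close> are integer matrices, \<^const>\<open>invertible_mat\<close> provides integer inverses, that
  is, membership in the general linear group over the integers. The numbering of the invariant
  factors \<open>f 0, \<dots>, f (r - 1)\<close> starts at 0.
\<close>

definition is_smith_normal_form :: "int mat \<Rightarrow> int mat \<Rightarrow> bool" where
  "is_smith_normal_form M S \<longleftrightarrow>
     (\<exists>n P Q r f.
        M \<in> carrier_mat n n \<and>
        P \<in> carrier_mat n n \<and> invertible_mat P \<and>
        Q \<in> carrier_mat n n \<and> invertible_mat Q \<and>
        r = vec_space.rank n (map_mat rat_of_int M) \<and>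
        (\<forall>i<r. f i > 0) \<and>
        (\<forall>i. Suc i < r \<longrightarrow> f i dvd f (Suc i)) \<and>
        S = mat_diag n (\<lambda>i. if i < r then f i else 0) \<and>
        S = P * M * Q)"

text \<open>
  The Smith normal form of a square integer matrix exists and is unique, so two matrices have the
  same Smith normal form if and only if some matrix is a Smith normal form of both. As \<open>S\<close> has the
  size of \<open>M\<close> and of \<open>N\<close>, these matrices have the same size.
\<close>

definition same_smith_normal_form :: "int mat \<Rightarrow> int mat \<Rightarrow> bool" where
  "same_smith_normal_form M N \<longleftrightarrow>
     (\<exists>S. is_smith_normal_form M S \<and> is_smith_normal_form N S)"

end

theory Submission
  imports Defs "HOL-Number_Theory.Cong"
begin

text \<open>
  A connected graph that is not complete contains an induced path \<open>u\<close>, \<open>v\<close>, \<open>w\<close>. For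
  \<open>e = -1\<close> and for \<open>e = 1\<close>, the matrix \<open>trs(G) + e A(G)\<close> therefore has a \<open>2\<times>2\<close> minor equal
  to 1: the one in rows \<open>u\<close>, \<open>v\<close> and columns \<open>v\<close>, \<open>w\<close>, where the entries at \<open>(u,v)\<close> and
  \<open>(v,w)\<close> are \<open>e\<close> and the entry at \<open>(u,w)\<close> is 0. The corresponding matrix of the complete
  graph is \<open>d I + e J\<close> with \<open>d = n - 1 - e\<close> and \<open>J\<close> the all-ones matrix. Modulo \<open>d\<close> it is a
  column times a row, and this property passes to all equivalent matrices and makes their \<open>2\<times>2\<close>
  minors divisible by \<open>d\<close> (\<open>rank_le_one_mod_mult_left\<close>, \<open>rank_le_one_mod_mult_right\<close>,
  \<open>rank_le_one_mod_minor\<close>). So an equivalence of the two matrices forces \<open>d = 1\<close>. As the induced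
  path gives \<open>n \<ge> 3\<close>, the only remaining case is \<open>e = 1\<close>, \<open>n = 3\<close>, where \<open>G\<close> is the path on three
  vertices.

  There the determinants 4 and 12 differ. The proof uses a substitute for them: \<open>I + J\<close> divides
  \<open>4 I\<close>, which is again invariant under equivalence, whereas the rows of the two end vertices of
  the path agree modulo 3, so that the matrix of the path can divide only those \<open>c I\<close> with \<open>c\<close> a
  multiple of 3.
\<close>

section \<open>Equivalence of integer matrices\<close>

lemma invertible_matE:
  assumes "invertible_mat P" and "P \<in> carrier_mat n n"
  obtains P' where "P' \<in> carrier_mat n n" "P * P' = 1\<^sub>m n" "P' * P = 1\<^sub>m n"
proof -
  obtain P' where P': "P * P' = 1\<^sub>m (dim_row P)" "P' * P = 1\<^sub>m (dim_row P')"
    using assms(1) unfolding invertible_mat_def inverts_mat_def by auto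
  have "dim_col P' = n"
    using arg_cong[OF P'(1), of dim_col] assms(2) by simp
  moreover have "dim_row P' = n"
    using arg_cong[OF P'(2), of dim_col] assms(2) by simp
  ultimately show ?thesis
    using that[of P'] P' assms(2) by auto
qed

lemma mult_mat_middle_cancel:
  fixes P :: "'a :: semiring_1 mat"
  assumes carr: "P \<in> carrier_mat n n" "P' \<in> carrier_mat n n" "Q \<in> carrier_mat n n"
      "Q' \<in> carrier_mat n n" "M \<in> carrier_mat n n"
    and inv: "P' * P = 1\<^sub>m n" "Q * Q' = 1\<^sub>m n"
  shows "P' * (P * M * Q) * Q' = M"
proof -
  have "P' * (P * M * Q) * Q' = (P' * P) * M * (Q * Q')"
    using carr by (simp add: assoc_mult_mat[of _ n n _ n _ n])
  then show ?thesis
    using carr by (simp add: inv)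
qed

text \<open>
  Both matrices are equivalent to a common matrix over the integers, hence to each other. The
  right inverses of \<open>U\<close> and \<open>V\<close> turn a right factor that takes \<open>N\<close> to a scalar matrix into one that
  does so for \<open>M\<close>.
\<close>

lemma same_smith_normal_formE:
  assumes "same_smith_normal_form M N" and "N \<in> carrier_mat n n"
  obtains U V U' V' where "M = U * N * V"
    "U \<in> carrier_mat n n" "U' \<in> carrier_mat n n" "U * U' = 1\<^sub>m n"
    "V \<in> carrier_mat n n" "V' \<in> carrier_mat n n" "V * V' = 1\<^sub>m n"
proof -
  obtain S where "is_smith_normal_form M S" "is_smith_normal_form N S"
    using assms(1) unfolding same_smith_normal_form_def by auto
  then obtain m P Q m' P2 Q2 where
    M: "M \<in> carrier_mat m m" and P: "P \<in> carrier_mat m m" "invertible_mat P"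
    and Q: "Q \<in> carrier_mat m m" "invertible_mat Q" and S1: "S = P * M * Q"
    and N: "N \<in> carrier_mat m' m'" and P2: "P2 \<in> carrier_mat m' m'" "invertible_mat P2"
    and Q2: "Q2 \<in> carrier_mat m' m'" "invertible_mat Q2" and S2: "S = P2 * N * Q2"
    unfolding is_smith_normal_form_def by blast
  have "m' = n"
    using N assms(2) by auto
  moreover have "m = m'"
    using arg_cong[OF S1, of dim_row] arg_cong[OF S2, of dim_row] P P2 by simp
  ultimately have eq: "m' = n" "m = n"
    by auto
  obtain P' where P': "P' \<in> carrier_mat n n" "P * P' = 1\<^sub>m n" "P' * P = 1\<^sub>m n"
    using invertible_matE[OF P(2) P(1)[unfolded eq]] .
  obtain Q' where Q': "Q' \<in> carrier_mat n n" "Q * Q' = 1\<^sub>m n" "Q' * Q = 1\<^sub>m n"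
    using invertible_matE[OF Q(2) Q(1)[unfolded eq]] .
  obtain P2' where P2': "P2' \<in> carrier_mat n n" "P2 * P2' = 1\<^sub>m n" "P2' * P2 = 1\<^sub>m n"
    using invertible_matE[OF P2(2) P2(1)[unfolded eq]] .
  obtain Q2' where Q2': "Q2' \<in> carrier_mat n n" "Q2 * Q2' = 1\<^sub>m n" "Q2' * Q2 = 1\<^sub>m n"
    using invertible_matE[OF Q2(2) Q2(1)[unfolded eq]] .
  note carr = P(1)[unfolded eq] Q(1)[unfolded eq] P2(1)[unfolded eq] Q2(1)[unfolded eq]
    P'(1) Q'(1) P2'(1) Q2'(1) assms(2) M[unfolded eq]
  have "M = P' * (P * M * Q) * Q'"
    using mult_mat_middle_cancel[OF carr(1,5,2,6,10) P'(3) Q'(2)] by simp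
  also have "\<dots> = P' * (P2 * N * Q2) * Q'"
    unfolding S1[symmetric] unfolding S2 ..
  also have "\<dots> = (P' * P2) * N * (Q2 * Q')"
    using carr by (simp add: assoc_mult_mat[of _ n n _ n _ n])
  finally have "M = (P' * P2) * N * (Q2 * Q')" .
  moreover have "(P' * P2) * (P2' * P) = 1\<^sub>m n"
  proof -
    have "(P' * P2) * (P2' * P) = P' * (P2 * P2') * P"
      using carr by (simp add: assoc_mult_mat[of _ n n _ n _ n])
    then show ?thesis using P' P2' carr by simp
  qed
  moreover have "(Q2 * Q') * (Q * Q2') = 1\<^sub>m n"
  proof -
    have "(Q2 * Q') * (Q * Q2') = Q2 * (Q' * Q) * Q2'"
      using carr by (simp add: assoc_mult_mat[of _ n n _ n _ n])
    then show ?thesis using Q' Q2' carr by simp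
  qed
  ultimately show ?thesis
    using that[of "P' * P2" "Q2 * Q'" "P2' * P" "Q * Q2'"] carr by auto
qed

text \<open>
  This condition makes all \<open>2\<times>2\<close> minors divisible by \<open>d\<close>. It replaces that divisibility because its
  invariance under multiplication is immediate, whereas that of the minors rests on the
  Cauchy--Binet formula.
\<close>

definition rank_le_one_mod :: "int \<Rightarrow> int mat \<Rightarrow> bool" where
  "rank_le_one_mod d M \<longleftrightarrow>
     (\<exists>a b. \<forall>i<dim_row M. \<forall>j<dim_col M. d dvd M $$ (i, j) - a i * b j)"

lemma rank_le_one_mod_mult_left:
  assumes "rank_le_one_mod d N" and "dim_col U = dim_row N"
  shows "rank_le_one_mod d (U * N)"
proof -
  obtain a b where ab: "\<And>i j. i < dim_row N \<Longrightarrow> j < dim_col N \<Longrightarrow> d dvd N $$ (i, j) - a i * b j"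
    using assms(1) unfolding rank_le_one_mod_def by blast
  let ?a = "\<lambda>i. \<Sum>k<dim_row N. U $$ (i, k) * a k"
  have "d dvd (U * N) $$ (i, j) - ?a i * b j" if "i < dim_row U" "j < dim_col N" for i j
  proof -
    have "(U * N) $$ (i, j) = (\<Sum>k<dim_row N. U $$ (i, k) * N $$ (k, j))"
      using that assms(2) by (simp add: scalar_prod_def atLeast0LessThan)
    then have "(U * N) $$ (i, j) - ?a i * b j
        = (\<Sum>k<dim_row N. U $$ (i, k) * (N $$ (k, j) - a k * b j))"
      by (simp add: sum_distrib_left sum_distrib_right sum_subtractf algebra_simps)
    then show ?thesis
      using ab that by (auto intro!: dvd_sum dvd_mult)
  qed
  then show ?thesis
    unfolding rank_le_one_mod_def by (intro exI[of _ ?a] exI[of _ b]) simp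
qed

lemma rank_le_one_mod_mult_right:
  assumes "rank_le_one_mod d N" and "dim_row V = dim_col N"
  shows "rank_le_one_mod d (N * V)"
proof -
  obtain a b where ab: "\<And>i j. i < dim_row N \<Longrightarrow> j < dim_col N \<Longrightarrow> d dvd N $$ (i, j) - a i * b j"
    using assms(1) unfolding rank_le_one_mod_def by blast
  let ?b = "\<lambda>j. \<Sum>k<dim_col N. b k * V $$ (k, j)"
  have "d dvd (N * V) $$ (i, j) - a i * ?b j" if "i < dim_row N" "j < dim_col V" for i j
  proof -
    have "(N * V) $$ (i, j) = (\<Sum>k<dim_col N. N $$ (i, k) * V $$ (k, j))"
      using that assms(2) by (simp add: scalar_prod_def atLeast0LessThan)
    then have "(N * V) $$ (i, j) - a i * ?b j
        = (\<Sum>k<dim_col N. (N $$ (i, k) - a i * b k) * V $$ (k, j))"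
      by (simp add: sum_distrib_left sum_subtractf algebra_simps)
    then show ?thesis
      using ab that by (auto intro!: dvd_sum dvd_mult2)
  qed
  then show ?thesis
    unfolding rank_le_one_mod_def by (intro exI[of _ a] exI[of _ ?b]) simp
qed

lemma rank_le_one_mod_minor:
  assumes "rank_le_one_mod d M"
    and "i < dim_row M" "k < dim_row M" "j < dim_col M" "l < dim_col M"
  shows "d dvd M $$ (i, j) * M $$ (k, l) - M $$ (i, l) * M $$ (k, j)"
proof -
  obtain a b where ab: "\<And>i j. i < dim_row M \<Longrightarrow> j < dim_col M \<Longrightarrow> [M $$ (i, j) = a i * b j] (mod d)"
    using assms(1) unfolding rank_le_one_mod_def cong_iff_dvd_diff by blast
  have "[M $$ (i, j) * M $$ (k, l) - M $$ (i, l) * M $$ (k, j)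
      = (a i * b j) * (a k * b l) - (a i * b l) * (a k * b j)] (mod d)"
    by (intro cong_diff cong_mult ab assms)
  then show ?thesis
    by (simp add: cong_iff_dvd_diff algebra_simps)
qed

text \<open>
  If \<open>N\<close> divides the scalar matrix \<open>c I\<close>, then \<open>c\<close> annihilates the cokernel of \<open>N\<close>, and equivalent
  matrices have isomorphic cokernels.
\<close>

lemma divides_scalar_mat_equivalent:
  fixes N :: "int mat"
  assumes carr: "N \<in> carrier_mat n n" "C \<in> carrier_mat n n"
      "U \<in> carrier_mat n n" "U' \<in> carrier_mat n n" "V \<in> carrier_mat n n" "V' \<in> carrier_mat n n"
    and inv: "U * U' = 1\<^sub>m n" "V * V' = 1\<^sub>m n"
    and NC: "N * C = c \<cdot>\<^sub>m 1\<^sub>m n"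
  shows "(U * N * V) * (V' * C * U') = c \<cdot>\<^sub>m 1\<^sub>m n"
proof -
  have "(U * N * V) * (V' * C * U') = U * N * (V * V') * C * U'"
    using carr by (simp add: assoc_mult_mat[of _ n n _ n _ n])
  also have "\<dots> = U * (N * C) * U'"
    using carr by (simp add: inv assoc_mult_mat[of _ n n _ n _ n])
  also have "\<dots> = c \<cdot>\<^sub>m (U * U')"
    using carr by (simp add: NC mult_smult_distrib[of _ n n _ n]
        mult_smult_assoc_mat[of _ n n _ n])
  finally show ?thesis
    by (simp add: inv)
qed

text \<open>
  The difference of the two rows, multiplied by \<open>C\<close>, is \<open>c\<close> times a difference of two
  unit vectors, and all its entries are multiples of \<open>d\<close>.
\<close>

lemma congruent_rows_dvd_scalar:
  fixes M :: "int mat"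
  assumes carr: "M \<in> carrier_mat n n" "C \<in> carrier_mat n n"
    and MC: "M * C = c \<cdot>\<^sub>m 1\<^sub>m n"
    and ij: "i < n" "j < n" "i \<noteq> j"
    and rows: "\<And>k. k < n \<Longrightarrow> d dvd M $$ (i, k) - M $$ (j, k)"
  shows "d dvd c"
proof -
  \<comment> \<open>Any column other than \<open>i\<close> and \<open>j\<close> would give the difference 0.\<close>
  have "(M * C) $$ (i, i) - (M * C) $$ (j, i)
      = (\<Sum>k<n. (M $$ (i, k) - M $$ (j, k)) * C $$ (k, i))"
    using carr ij by (simp add: scalar_prod_def atLeast0LessThan sum_subtractf algebra_simps)
  moreover have "(M * C) $$ (i, i) - (M * C) $$ (j, i) = c"
    using ij by (simp add: MC)
  ultimately show ?thesis
    using rows by (auto intro!: dvd_sum dvd_mult2)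
qed

section \<open>Distances, induced paths and complete graphs\<close>

lemma (in wf_digraph) graph_dist_self: "u \<in> verts G \<Longrightarrow> graph_dist G u u = 0"
  unfolding graph_dist_def by (rule Least_eq_0) (auto simp: apath_def awalk_def)

lemma (in wf_digraph) graph_dist_adjacent:
  assumes "(u, v) \<in> arcs_ends G" and "u \<noteq> v"
  shows "graph_dist G u v = 1"
  unfolding graph_dist_def
proof (rule Least_equality)
  obtain a where "a \<in> arcs G" "tail G a = u" "head G a = v"
    using assms(1) unfolding arcs_ends_conv by auto
  then have "apath u [a] v"
    using assms(2) by (auto simp: apath_def awalk_def)
  then show "\<exists>p. apath u p v \<and> length p = 1"
    by (intro exI[of _ "[a]"]) simp
next
  fix k assume "\<exists>p. apath u p v \<and> length p = k"
  then show "1 \<le> k"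
    using assms(2) by (cases k) (auto simp: apath_def awalk_def)
qed

lemma (in wf_digraph) graph_dist_two:
  assumes "(u, v) \<in> arcs_ends G" "(v, w) \<in> arcs_ends G" "(u, w) \<notin> arcs_ends G"
    and "u \<noteq> v" "v \<noteq> w" "u \<noteq> w"
  shows "graph_dist G u w = 2"
  unfolding graph_dist_def
proof (rule Least_equality)
  obtain a where a: "a \<in> arcs G" "tail G a = u" "head G a = v"
    using assms(1) unfolding arcs_ends_conv by auto
  obtain b where b: "b \<in> arcs G" "tail G b = v" "head G b = w"
    using assms(2) unfolding arcs_ends_conv by auto
  have "apath u [a, b] w"
    using a b assms(4-) by (auto simp: apath_def awalk_def)
  then show "\<exists>p. apath u p w \<and> length p = 2"
    by (intro exI[of _ "[a, b]"]) simp
next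
  fix k assume "\<exists>p. apath u p w \<and> length p = k"
  then obtain p where p: "apath u p w" "length p = k"
    by auto
  have "p \<noteq> []"
    using p(1) assms(6) by (auto simp: apath_def awalk_def)
  moreover have "p \<noteq> [a]" for a
    using p(1) assms(3) by (auto simp: apath_def awalk_def arcs_ends_conv)
  ultimately show "2 \<le> k"
    using p(2) by (cases p rule: list.exhaust; cases "tl p") auto
qed

text \<open>
  Without an induced path on three vertices, being equal or adjacent is a transitive relation, so
  it contains reachability.
\<close>

lemma (in graph) noncomplete_induced_path:
  assumes "Digraph_Component.connected G"
    and "arcs_ends G \<noteq> {(u, v). (u, v) \<in> verts G \<times> verts G \<and> u \<noteq> v}"
  obtains (path) u v w where "(u, v) \<in> arcs_ends G" "(v, w) \<in> arcs_ends G" "(u, w) \<notin> arcs_ends G"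
    "u \<noteq> v" "v \<noteq> w" "u \<noteq> w"
proof (rule ccontr)
  assume "\<not> thesis"
  have irrefl: "x \<noteq> y" if "(x, y) \<in> arcs_ends G" for x y
    using that no_loops unfolding arcs_ends_conv by auto
  have trans: "u = w \<or> (u, w) \<in> arcs_ends G"
    if uv: "(u, v) \<in> arcs_ends G" and vw: "(v, w) \<in> arcs_ends G" for u v w
    using path[OF uv vw] irrefl[OF uv] irrefl[OF vw] \<open>\<not> thesis\<close> by blast
  have "x = y \<or> (x, y) \<in> arcs_ends G" if "x \<in> verts G" "y \<in> verts G" for x y
  proof -
    have "x \<rightarrow>\<^sup>*\<^bsub>G\<^esub> y"
      using symmetric_connected_imp_strongly_connected[OF sym_arcs assms(1)] that by blast
    then show ?thesis
      by (induction rule: reachable_induct) (auto dest: trans)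
  qed
  moreover have "x \<in> verts G \<and> y \<in> verts G" if "(x, y) \<in> arcs_ends G" for x y
    using that unfolding arcs_ends_conv by auto
  ultimately show False
    using assms(2) irrefl by blast
qed

text \<open>
  Any bijection of the vertices works. As parallel arcs do not exist, an arc is sent to the unique arc
  between the images of its ends.
\<close>

lemma complete_digraph_iso:
  assumes "complete_digraph n G" and "complete_digraph n H"
  shows "digraph_iso G H"
proof -
  interpret G: graph G using assms(1) by (simp add: complete_digraph_def)
  interpret H: graph H using assms(2) by (simp add: complete_digraph_def)
  obtain h where h: "bij_betw h (verts G) (verts H)"
    using assms finite_same_card_bij[OF G.finite_verts H.finite_verts]
    by (auto simp: complete_digraph_def)
  have ends: "bij_betw (arc_to_ends G) (arcs G) {(u, v). (u, v) \<in> verts G \<times> verts G \<and> u \<noteq> v}"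
      "bij_betw (arc_to_ends H) (arcs H) {(u, v). (u, v) \<in> verts H \<times> verts H \<and> u \<noteq> v}"
    using assms G.inj_on_arc_to_ends H.inj_on_arc_to_ends
    by (auto simp: complete_digraph_def bij_betw_def arcs_ends_def)
  have prod: "bij_betw (map_prod h h) {(u, v). (u, v) \<in> verts G \<times> verts G \<and> u \<noteq> v}
      {(u, v). (u, v) \<in> verts H \<times> verts H \<and> u \<noteq> v}"
  proof (rule bij_betw_imageI)
    have inj: "inj_on h (verts G)" and img: "h ` verts G = verts H"
      using h by (auto simp: bij_betw_def)
    show "inj_on (map_prod h h) {(u, v). (u, v) \<in> verts G \<times> verts G \<and> u \<noteq> v}"
      by (rule inj_on_subset[OF map_prod_inj_on[OF inj inj]]) auto
    show "map_prod h h ` {(u, v). (u, v) \<in> verts G \<times> verts G \<and> u \<noteq> v}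
        = {(u, v). (u, v) \<in> verts H \<times> verts H \<and> u \<noteq> v}"
      unfolding img[symmetric] using inj_on_eq_iff[OF inj] by (auto simp: image_iff)
  qed
  define g where "g = inv_into (arcs H) (arc_to_ends H) \<circ> (map_prod h h \<circ> arc_to_ends G)"
  have g: "bij_betw g (arcs G) (arcs H)"
    unfolding g_def
    by (rule bij_betw_trans[OF bij_betw_trans[OF ends(1) prod] bij_betw_inv_into[OF ends(2)]])
  have gends: "arc_to_ends H (g a) = map_prod h h (arc_to_ends G a)" if "a \<in> arcs G" for a
    using bij_betw_inv_into_right[OF ends(2)]
      bij_betwE[OF bij_betw_trans[OF ends(1) prod], rule_format, OF that]
    by (simp add: g_def)
  define f where "f = \<lparr>iso_verts = h, iso_arcs = g, iso_head = head H, iso_tail = tail H\<rparr>"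
  have "pre_digraph.digraph_isomorphism G f"
    using h g gends G.wf_digraph
    by (auto simp: pre_digraph.digraph_isomorphism_def f_def bij_betw_def arc_to_ends_def)
  moreover have "H = app_iso f G"
    using h g by (auto simp: app_iso_def f_def bij_betw_def)
  ultimately show ?thesis
    unfolding digraph_iso_def by blast
qed

section \<open>The transmission matrices\<close>

text \<open>
  The two matrices differ only in the sign \<open>e\<close> of the adjacency part, so they are treated together.
\<close>

definition signed_Atrs :: "int \<Rightarrow> ('a, 'b) pre_digraph \<Rightarrow> 'a list \<Rightarrow> int mat" where
  "signed_Atrs e G vs = trs_matrix G vs + e \<cdot>\<^sub>m adjacency_matrix G vs"

lemma signed_Atrs_simps: "Atrs G vs = signed_Atrs (- 1) G vs" "Atrs_plus G vs = signed_Atrs 1 G vs"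
  by (auto simp: Atrs_def Atrs_plus_def signed_Atrs_def trs_matrix_def mat_diag_def
      adjacency_matrix_def)

lemma signed_Atrs_carrier: "signed_Atrs e G vs \<in> carrier_mat (length vs) (length vs)"
  by (simp add: signed_Atrs_def trs_matrix_def adjacency_matrix_def)

lemma (in loopfree_digraph) signed_Atrs_index:
  assumes "distinct vs" "i < length vs" "j < length vs"
  shows "signed_Atrs e G vs $$ (i, j) =
    (if i = j then int (transmission G (vs ! i))
     else if (vs ! i, vs ! j) \<in> arcs_ends G then e else 0)"
proof -
  have "(u, u) \<notin> arcs_ends G" for u
    using no_loops unfolding arcs_ends_conv by auto
  then show ?thesis
    using assms
    by (auto simp: signed_Atrs_def trs_matrix_def mat_diag_def adjacency_matrix_def)
qed

lemma complete_digraph_transmission: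
  assumes "complete_digraph n K" and "u \<in> verts K"
  shows "transmission K u = n - 1"
proof -
  interpret graph K using assms by (simp add: complete_digraph_def)
  have "graph_dist K u v = 1" if "v \<in> verts K - {u}" for v
    using that assms by (intro graph_dist_adjacent) (auto simp: complete_digraph_def)
  then have "(\<Sum>v\<in>verts K - {u}. graph_dist K u v) = n - 1"
    using assms by (simp add: complete_digraph_def)
  then show ?thesis
    using assms(2) by (simp add: transmission_def sum.remove[of _ u] graph_dist_self)
qed

lemma complete_digraph_signed_Atrs_index:
  assumes "complete_digraph n K" "distinct ws" "set ws = verts K" "i < n" "j < n"
  shows "signed_Atrs e K ws $$ (i, j) = (if i = j then int n - 1 else e)"
proof -
  interpret graph K using assms by (simp add: complete_digraph_def)
  have len: "length ws = n"
    using assms distinct_card[of ws] by (simp add: complete_digraph_def)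
  then have "ws ! i \<in> verts K" "ws ! j \<in> verts K" "ws ! i = ws ! j \<longleftrightarrow> i = j"
    using assms nth_mem[of _ ws] nth_eq_iff_index_eq[of ws] by auto
  then show ?thesis
    using assms len complete_digraph_transmission[OF assms(1)]
    by (auto simp: signed_Atrs_index complete_digraph_def)
qed

lemma complete_digraph_rank_le_one_mod:
  assumes "complete_digraph n K" "distinct ws" "set ws = verts K"
  shows "rank_le_one_mod (int n - 1 - e) (signed_Atrs e K ws)"
proof -
  have "length ws = n"
    using assms distinct_card[of ws] by (simp add: complete_digraph_def)
  then show ?thesis
    \<comment> \<open>Modulo \<open>n - 1 - e\<close>, all entries are \<open>e\<close>.\<close>
    unfolding rank_le_one_mod_def
    using signed_Atrs_carrier[of e K ws] complete_digraph_signed_Atrs_index[OF assms]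
    by (intro exI[of _ "\<lambda>_. e"] exI[of _ "\<lambda>_. 1"]) auto
qed

text \<open>The right factor is \<open>4 I - J\<close>, which comes from \<open>J\<^sup>2 = 3 J\<close>: \<open>(I + J) (4 I - J) = 4 I\<close>.\<close>

lemma complete_digraph_three_divides_scalar:
  assumes "complete_digraph 3 K" "distinct ws" "set ws = verts K"
  shows "signed_Atrs 1 K ws * mat 3 3 (\<lambda>(i, j). if i = j then 3 else - 1) = 4 \<cdot>\<^sub>m 1\<^sub>m 3"
proof -
  have len: "length ws = 3"
    using assms distinct_card[of ws] by (simp add: complete_digraph_def)
  have "signed_Atrs 1 K ws = mat 3 3 (\<lambda>(i, j). if i = j then 2 else 1)"
    using signed_Atrs_carrier[of 1 K ws] complete_digraph_signed_Atrs_index[OF assms]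
    by (intro eq_matI) (auto simp: len)
  moreover have "i < 3 \<longleftrightarrow> i = 0 \<or> i = 1 \<or> i = 2" and "{0..<3} = {0, 1, 2 :: nat}" for i :: nat
    by auto
  ultimately show ?thesis
    by (intro eq_matI) (auto simp: scalar_prod_def)
qed

text \<open>
  The end vertices have transmission 3, so their rows \<open>(3, e, 0)\<close> and \<open>(0, e, 3)\<close> agree modulo 3.
\<close>

lemma (in graph) path_three_congruent_rows:
  assumes path: "(u, v) \<in> arcs_ends G" "(v, w) \<in> arcs_ends G" "(u, w) \<notin> arcs_ends G"
      "u \<noteq> v" "v \<noteq> w" "u \<noteq> w"
    and V: "verts G = {u, v, w}"
    and vs: "distinct vs" "set vs = verts G"
    and ij: "i < length vs" "j < length vs" "vs ! i = u" "vs ! j = w"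
    and k: "k < length vs"
  shows "3 dvd signed_Atrs e G vs $$ (i, k) - signed_Atrs e G vs $$ (j, k)"
proof -
  have rev: "(v, u) \<in> arcs_ends G" "(w, v) \<in> arcs_ends G" "(w, u) \<notin> arcs_ends G"
    using path arcs_ends_symmetric[OF sym_arcs] by blast+
  have "transmission G u = 3"
    using graph_dist_self[of u] graph_dist_adjacent[of u v] graph_dist_two[of u v w] path V
    by (simp add: transmission_def)
  moreover have "transmission G w = 3"
    using graph_dist_self[of w] graph_dist_adjacent[of w v] graph_dist_two[of w v u] path rev V
    by (simp add: transmission_def)
  moreover have "i \<noteq> j"
    using ij path(6) by auto
  moreover have "k = i \<or> k = j \<or> k \<noteq> i \<and> k \<noteq> j \<and> vs ! k = v"
  proof -
    have "vs ! k \<in> {u, v, w}"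
      using nth_mem[OF k] vs V by simp
    then show ?thesis
      using ij k nth_eq_iff_index_eq[OF vs(1) k ij(1)] nth_eq_iff_index_eq[OF vs(1) k ij(2)]
      by auto
  qed
  ultimately show ?thesis
    using path rev ij k by (elim disjE conjE) (simp_all add: signed_Atrs_index[OF vs(1)])
qed

section \<open>Complete graphs are determined by the Smith normal form\<close>

lemma same_smith_normal_form_complete:
  fixes G :: "('a, 'b) pre_digraph" and K :: "('c, 'd) pre_digraph"
  assumes K: "complete_digraph n K" "distinct ws" "set ws = verts K"
    and G: "graph G" "Digraph_Component.connected G"
    and vs: "distinct vs" "set vs = verts G"
    and e: "e = 1 \<or> e = - 1"
    and same: "same_smith_normal_form (signed_Atrs e G vs) (signed_Atrs e K ws)"
  shows "digraph_iso G K"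
proof -
  interpret graph G by fact
  let ?M = "signed_Atrs e G vs" and ?N = "signed_Atrs e K ws"
  have "length ws = n"
    using K distinct_card[of ws] by (simp add: complete_digraph_def)
  then have N: "?N \<in> carrier_mat n n"
    using signed_Atrs_carrier[of e K ws] by simp
  obtain U V U' V' where M_eq: "?M = U * ?N * V"
    and U: "U \<in> carrier_mat n n" "U' \<in> carrier_mat n n" "U * U' = 1\<^sub>m n"
    and V: "V \<in> carrier_mat n n" "V' \<in> carrier_mat n n" "V * V' = 1\<^sub>m n"
    using same_smith_normal_formE[OF same N] by blast
  have M: "?M \<in> carrier_mat n n"
    unfolding M_eq using U V N by simp
  then have len: "length vs = n"
    using signed_Atrs_carrier[of e G vs] by (metis carrier_matD(1))
  then have card: "card (verts G) = n"
    using vs distinct_card[of vs] by simp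
  have "arcs_ends G = {(u, v). (u, v) \<in> verts G \<times> verts G \<and> u \<noteq> v}"
  proof (rule ccontr)
    assume "\<not> ?thesis"
    then obtain u v w where path: "(u, v) \<in> arcs_ends G" "(v, w) \<in> arcs_ends G"
        "(u, w) \<notin> arcs_ends G" "u \<noteq> v" "v \<noteq> w" "u \<noteq> w"
      using noncomplete_induced_path[OF G(2)] by blast
    then have uvw: "{u, v, w} \<subseteq> verts G"
      unfolding arcs_ends_conv by auto
    have n3: "3 \<le> n"
      using card_mono[OF finite_verts uvw] path card by simp
    obtain i j k where ijk: "i < n" "vs ! i = u" "j < n" "vs ! j = v" "k < n" "vs ! k = w"
      using uvw vs len by (metis in_set_conv_nth insert_subset)
    then have neq: "i \<noteq> j" "j \<noteq> k" "i \<noteq> k"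
      using path by auto
    have "rank_le_one_mod (int n - 1 - e) ?M"
      unfolding M_eq using U V N
      by (intro rank_le_one_mod_mult_left rank_le_one_mod_mult_right
          complete_digraph_rank_le_one_mod K) auto
    then have "int n - 1 - e dvd ?M $$ (i, j) * ?M $$ (j, k) - ?M $$ (i, k) * ?M $$ (j, j)"
      using ijk M by (intro rank_le_one_mod_minor) auto
    then have "int n - 1 - e dvd 1"
      using ijk neq path len vs e by (auto simp: signed_Atrs_index)
    \<comment> \<open>For \<open>e = - 1\<close> the divisor \<open>n\<close> is at least 3, for \<open>e = 1\<close> it is \<open>n - 2\<close>.\<close>
    then have small: "e = 1" "n = 3"
      using e n3 by auto
    have "{u, v, w} = verts G"
      using uvw path card small by (intro card_subset_eq) auto
    then have rows: "3 dvd ?M $$ (i, l) - ?M $$ (k, l)" if "l < n" for l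
      using path_three_congruent_rows[OF path _ vs, of i k l e] ijk that len by auto
    have "?N * mat 3 3 (\<lambda>(i, j). if i = j then 3 else - 1) = 4 \<cdot>\<^sub>m 1\<^sub>m n"
      using complete_digraph_three_divides_scalar K small by blast
    then have "?M * (V' * mat 3 3 (\<lambda>(i, j). if i = j then 3 else - 1) * U') = 4 \<cdot>\<^sub>m 1\<^sub>m n"
      unfolding M_eq using U V N small by (intro divides_scalar_mat_equivalent) auto
    then have "(3 :: int) dvd 4"
      using U V M small ijk neq rows
      by (intro congruent_rows_dvd_scalar[of ?M n _ 4 i k 3]) auto
    then show False
      by simp
  qed
  then have "complete_digraph n G"
    using G card by (simp add: complete_digraph_def)
  then show ?thesis
    using K(1) complete_digraph_iso by blast
qed

theorem theorem3p15:
  fixes n :: nat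
    and K :: "('c, 'd) pre_digraph" and ws :: "'c list"
    and G :: "('a, 'b) pre_digraph" and vs :: "'a list"
  assumes "n \<ge> 1"
    and "complete_digraph n K" and "distinct ws" and "set ws = verts K"
    and "graph G" and "Digraph_Component.connected G"
    and "distinct vs" and "set vs = verts G"
  shows "(same_smith_normal_form (Atrs G vs) (Atrs K ws) \<longrightarrow> digraph_iso G K) \<and>
         (same_smith_normal_form (Atrs_plus G vs) (Atrs_plus K ws) \<longrightarrow> digraph_iso G K)"
  using same_smith_normal_form_complete[OF assms(2-8)] by (auto simp: signed_Atrs_simps)

end
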